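(* Let $n\ge1$ and $t_1\ne0$. Then $$\frac1zX_{-n}=a_nX_{-n-1}+b_nX_{-n}+c_nY_n+d_nY_{n-1}$$ with $$a_n=\frac{(1-t_1t_2q^n)(1-t_1t_3q^n)(1-t_1t_4q^n)(1-t_3t_4q^{n-1})(1-t_1t_2t_3t_4q^{n-1})}{t_1(1-t_3t_4q^n)(1-t_1t_2t_3t_4q^{2n-1})(1-t_1t_2t_3t_4q^{2n})},$$ $$b_n=\frac{q^{n-1}\big(-t_3-t_4+(t_1+t_2)t_3t_4q^{n-1}\big)\big(-1-t_1t_2+t_1t_2t_3t_4q^{n-1}+t_1t_2q^n\big)}{(1-t_1t_2t_3t_4q^{2n-2})(1-t_1t_2t_3t_4q^{2n-1})},$$ $$c_n=-\frac{(1-t_3t_4q^{n-1})(1-t_1t_2t_3t_4q^{n-1})\big(-t_1-t_2+t_1t_2(t_3+t_4)q^n\big)}{(1-t_1t_2t_3t_4q^{2n-1})(1-t_1t_2t_3t_4q^{2n})},$$ $$d_n=\frac{t_1(1-t_2t_3q^{n-1})(1-t_2t_4q^{n-1})(1-t_3t_4q^{n-1})\big(-1-t_1t_2+t_1t_2t_3t_4q^{n-1}+t_1t_2q^n\big)}{(1-t_1t_2q^{n-1})(1-t_1t_2t_3t_4q^{2n-2})(1-t_1t_2t_3t_4q^{2n-1})}.$$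
   Context: Standing assumptions: $0<q<1$; $\mathbf t=(t_1,t_2,t_3,t_4)$ with each $t_i$ real and $|t_i|<1$. Notation: $(a;q)_k=\prod_{i=0}^{k-1}(1-aq^i)$, $(a_1,\dots,a_r;q)_k=\prod_j(a_j;q)_k$, and ${}_4\phi_3(a_1,a_2,a_3,a_4;b_1,b_2,b_3;q,q)=\sum_{k\ge 0}\frac{(a_1,a_2,a_3,a_4;q)_k}{(q,b_1,b_2,b_3;q)_k}q^k$. $R_n={}_4\phi_3(q^{-n},t_1t_2t_3t_4q^{n-1},t_1z,t_1/z;\;t_1t_2,t_1t_3,t_1t_4;q,q)$ for $n\ge0$; $S_0=0$ and for $n\ge1$, $S_n=z(1-t_3/z)(1-t_4/z)\;{}_4\phi_3(q^{1-n},t_1t_2t_3t_4q^{n},t_1z,qt_1/z;\;qt_1t_2,qt_1t_3,qt_1t_4;q,q)$. These are Laurent polynomials in $z$. Define the Laurent polynomials $X_{-n}=(1-t_1t_2)(1-t_1t_3)(1-t_1t_4)R_n-t_1(1-t_1t_2t_3t_4q^{n-1})S_n$ for $n>0$, $Y_{n}=q^n(1-t_1t_2)(1-t_1t_3)(1-t_1t_4)R_n+t_1(1-q^{n})S_n$ for $n\ge0$. *)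

theory Defs
  imports "HOL-Analysis.Analysis"
begin

definition qpoch :: "complex \<Rightarrow> complex \<Rightarrow> nat \<Rightarrow> complex" where
  "qpoch a q k = (\<Prod>i<k. 1 - a * q ^ i)"

definition phi43 ::
  "complex \<Rightarrow> complex \<Rightarrow> complex \<Rightarrow> complex \<Rightarrow> complex \<Rightarrow> complex \<Rightarrow> complex \<Rightarrow> complex \<Rightarrow> complex" where
  "phi43 a1 a2 a3 a4 b1 b2 b3 q =
     (\<Sum>k. (qpoch a1 q k * qpoch a2 q k * qpoch a3 q k * qpoch a4 q k) /
            (qpoch q q k * qpoch b1 q k * qpoch b2 q k * qpoch b3 q k) * q ^ k)"

text \<open>
  The parameters \<open>q, t1, \<dots>, t4\<close> are real; Laurent polynomials in \<open>z\<close> are rendered as functions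
  of a nonzero complex number \<open>z\<close>. Exponents such as \<open>n - 1\<close> are formed in the integers
  (operator \<open>powi\<close>), so that no truncated subtraction occurs.
\<close>

definition R :: "real \<Rightarrow> real \<Rightarrow> real \<Rightarrow> real \<Rightarrow> real \<Rightarrow> nat \<Rightarrow> complex \<Rightarrow> complex" where
  "R q t1 t2 t3 t4 n z =
     phi43 (of_real (q powi (- int n))) (of_real (t1*t2*t3*t4 * q powi (int n - 1)))
       (of_real t1 * z) (of_real t1 / z)
       (of_real (t1*t2)) (of_real (t1*t3)) (of_real (t1*t4)) (of_real q)"

definition S :: "real \<Rightarrow> real \<Rightarrow> real \<Rightarrow> real \<Rightarrow> real \<Rightarrow> nat \<Rightarrow> complex \<Rightarrow> complex" where
  "S q t1 t2 t3 t4 n z =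
     (if n = 0 then 0
      else z * (1 - of_real t3 / z) * (1 - of_real t4 / z) *
        phi43 (of_real (q powi (1 - int n))) (of_real (t1*t2*t3*t4 * q ^ n))
          (of_real t1 * z) (of_real (q * t1) / z)
          (of_real (q*t1*t2)) (of_real (q*t1*t3)) (of_real (q*t1*t4)) (of_real q))"

text \<open>\<open>X_neg \<dots> n\<close> is $X_{-n}$; it is only meaningful for \<open>n > 0\<close>.\<close>

definition X_neg :: "real \<Rightarrow> real \<Rightarrow> real \<Rightarrow> real \<Rightarrow> real \<Rightarrow> nat \<Rightarrow> complex \<Rightarrow> complex" where
  "X_neg q t1 t2 t3 t4 n z =
     of_real ((1 - t1*t2) * (1 - t1*t3) * (1 - t1*t4)) * R q t1 t2 t3 t4 n z
     - of_real (t1 * (1 - t1*t2*t3*t4 * q powi (int n - 1))) * S q t1 t2 t3 t4 n z"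

definition Y :: "real \<Rightarrow> real \<Rightarrow> real \<Rightarrow> real \<Rightarrow> real \<Rightarrow> nat \<Rightarrow> complex \<Rightarrow> complex" where
  "Y q t1 t2 t3 t4 n z =
     of_real (q ^ n * (1 - t1*t2) * (1 - t1*t3) * (1 - t1*t4)) * R q t1 t2 t3 t4 n z
     + of_real (t1 * (1 - q ^ n)) * S q t1 t2 t3 t4 n z"

definition coeff_a :: "real \<Rightarrow> real \<Rightarrow> real \<Rightarrow> real \<Rightarrow> real \<Rightarrow> nat \<Rightarrow> real" where
  "coeff_a q t1 t2 t3 t4 n =
     ((1 - t1*t2 * q ^ n) * (1 - t1*t3 * q ^ n) * (1 - t1*t4 * q ^ n) *
      (1 - t3*t4 * q powi (int n - 1)) * (1 - t1*t2*t3*t4 * q powi (int n - 1))) /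
     (t1 * (1 - t3*t4 * q ^ n) *
      (1 - t1*t2*t3*t4 * q powi (2 * int n - 1)) * (1 - t1*t2*t3*t4 * q ^ (2 * n)))"

definition coeff_b :: "real \<Rightarrow> real \<Rightarrow> real \<Rightarrow> real \<Rightarrow> real \<Rightarrow> nat \<Rightarrow> real" where
  "coeff_b q t1 t2 t3 t4 n =
     (q powi (int n - 1) * (- t3 - t4 + (t1 + t2) * t3 * t4 * q powi (int n - 1)) *
      (- 1 - t1*t2 + t1*t2*t3*t4 * q powi (int n - 1) + t1*t2 * q ^ n)) /
     ((1 - t1*t2*t3*t4 * q powi (2 * int n - 2)) * (1 - t1*t2*t3*t4 * q powi (2 * int n - 1)))"

definition coeff_c :: "real \<Rightarrow> real \<Rightarrow> real \<Rightarrow> real \<Rightarrow> real \<Rightarrow> nat \<Rightarrow> real" where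
  "coeff_c q t1 t2 t3 t4 n =
     - (((1 - t3*t4 * q powi (int n - 1)) * (1 - t1*t2*t3*t4 * q powi (int n - 1)) *
         (- t1 - t2 + t1*t2 * (t3 + t4) * q ^ n)) /
        ((1 - t1*t2*t3*t4 * q powi (2 * int n - 1)) * (1 - t1*t2*t3*t4 * q ^ (2 * n))))"

definition coeff_d :: "real \<Rightarrow> real \<Rightarrow> real \<Rightarrow> real \<Rightarrow> real \<Rightarrow> nat \<Rightarrow> real" where
  "coeff_d q t1 t2 t3 t4 n =
     (t1 * (1 - t2*t3 * q powi (int n - 1)) * (1 - t2*t4 * q powi (int n - 1)) *
      (1 - t3*t4 * q powi (int n - 1)) *
      (- 1 - t1*t2 + t1*t2*t3*t4 * q powi (int n - 1) + t1*t2 * q ^ n)) /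
     ((1 - t1*t2 * q powi (int n - 1)) *
      (1 - t1*t2*t3*t4 * q powi (2 * int n - 2)) * (1 - t1*t2*t3*t4 * q powi (2 * int n - 1)))"

end

theory Submission
  imports Defs
begin

text \<open>
  Expand everything in \<open>\<gamma>\<^sub>k = (t\<^sub>1z, qt\<^sub>1/z; q)\<^sub>k\<close> and \<open>\<delta>\<^sub>k = (t\<^sub>1z; q)\<^sub>k\<^sub>+\<^sub>1 (qt\<^sub>1/z; q)\<^sub>k / z\<close>.
  In this basis the coefficients of \<open>X\<^sub>-\<^sub>m\<^sub>-\<^sub>1\<close> and \<open>Y\<^sub>m\<close> factor completely, and both are
  multiples of the same term \<open>E m k = (q\<^sup>-\<^sup>m, t\<^sub>1t\<^sub>2t\<^sub>3t\<^sub>4q\<^sup>m; q)\<^sub>k q\<^sup>k / (q, t\<^sub>1t\<^sub>2, t\<^sub>1t\<^sub>3, t\<^sub>1t\<^sub>4; q)\<^sub>k\<close>.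
  Multiplication by \<open>1/z\<close> moves \<open>\<gamma>\<^sub>k\<close> and \<open>\<delta>\<^sub>k\<close> only to neighbouring basis elements, so the
  recurrence can be compared coefficientwise. After division by the term of \<open>R\<^sub>m\<^sub>+\<^sub>1\<close>, the
  comparison is a polynomial identity in \<open>K = q\<^sup>k\<close>, linear for \<open>\<gamma>\<^sub>k\<close> and quadratic for \<open>\<delta>\<^sub>k\<close>
  (with \<open>M = q\<^sup>m\<close> and \<open>N = q\<^sup>m\<^sup>+\<^sup>1\<close>).
\<close>

section \<open>Coefficient identities as rational functions of K = q^k\<close>

text \<open>The summands pair off: the first and third carry \<open>1 - p*M*K\<close>, the second
  and fourth \<open>(N - K) / (N - 1)\<close>. Adding within a pair cancels one denominator
  (\<open>?D3\<close>, respectively \<open>?D1\<close>) and leaves only \<open>?D2\<close>. On the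
  left the K^2 terms cancel, so a linear identity in K remains.\<close>

lemma gam_coeff:
  fixes t1 t2 t3 t4 q M K :: "'a::field"
  defines "A \<equiv> t1*t2" and "B \<equiv> t1*t3" and "C \<equiv> t1*t4" and "p \<equiv> t1*t2*t3*t4" and "N \<equiv> q*M"
  assumes nz: "t1 \<noteq> 0" "1 - p*M^2 \<noteq> 0" "1 - p*(q*M^2) \<noteq> 0" "1 - p*(q*M)^2 \<noteq> 0" "N - 1 \<noteq> 0"
  shows "- (t1 * (A*K*(N - K) + (1 - K)*(1 - A*K))) / (N - 1) =
     - A * ((1 - A*N)*(1 - B*N)*(1 - C*N) / (t1 * (1 - p*(q*M^2)) * (1 - p*(q*M)^2))) * (1 - p*M*K)
     - A * (M * (- t3 - t4 + (t1 + t2)*t3*t4*M) * (- 1 - A + p*M + A*N) / ((1 - p*M^2) * (1 - p*(q*M^2)))) * (N - K) / (N - 1)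
     + (- ((1 - A*N) * (- t1 - t2 + A*(t3 + t4)*N) / ((1 - p*(q*M^2)) * (1 - p*(q*M)^2)))) * (1 - p*M*K)
     + (t1 * (1 - t2*t3*M) * (1 - t2*t4*M) * (- 1 - A + p*M + A*N) / ((1 - p*M^2) * (1 - p*(q*M^2)))) * (N - K) / (N - 1)"
proof -
  let ?D1 = "1 - p*M^2" and ?D2 = "1 - p*(q*M^2)" and ?D3 = "1 - p*(q*M)^2"
  let ?w = "- 1 - A + p*M + A*N"
  have 1: "- A * ((1 - A*N)*(1 - B*N)*(1 - C*N) / (t1 * ?D2 * ?D3)) + (- ((1 - A*N) * (- t1 - t2 + A*(t3 + t4)*N) / (?D2 * ?D3))) = t1*(1-A*N)/?D2"
  proof -
    have "- A * ((1 - A*N)*(1 - B*N)*(1 - C*N) / (t1 * ?D2 * ?D3)) + (- ((1 - A*N) * (- t1 - t2 + A*(t3 + t4)*N) / (?D2 * ?D3)))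
     = (1 - A*N) * (- t2*(1 - B*N)*(1 - C*N) - (- t1 - t2 + A*(t3 + t4)*N)) / (?D2 * ?D3)"
      using nz(1) unfolding A_def by (simp add: divide_simps nz) (simp add: algebra_simps)
    also have "- t2*(1 - B*N)*(1 - C*N) - (- t1 - t2 + A*(t3 + t4)*N) = t1 * ?D3"
      unfolding A_def B_def C_def p_def N_def by algebra
    finally show ?thesis using nz(4) by simp
  qed
  have 2: "- A * (M * (- t3 - t4 + (t1 + t2)*t3*t4*M) * ?w / (?D1 * ?D2)) + t1 * (1 - t2*t3*M) * (1 - t2*t4*M) * ?w / (?D1 * ?D2) = t1 * ?w / ?D2"
  proof -
    have "- A * (M * (- t3 - t4 + (t1 + t2)*t3*t4*M) * ?w / (?D1 * ?D2)) + t1 * (1 - t2*t3*M) * (1 - t2*t4*M) * ?w / (?D1 * ?D2)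
      = (- A * (M * (- t3 - t4 + (t1 + t2)*t3*t4*M)) + t1 * (1 - t2*t3*M) * (1 - t2*t4*M)) * ?w / (?D1 * ?D2)"
      by (simp add: add_divide_distrib diff_divide_distrib algebra_simps)
    also have "- A * (M * (- t3 - t4 + (t1 + t2)*t3*t4*M)) + t1 * (1 - t2*t3*M) * (1 - t2*t4*M) = t1 * ?D1"
      unfolding A_def p_def by algebra
    finally show ?thesis using nz(2) by simp
  qed
  have 3: "- (t1 * (A*K*(N - K) + (1 - K)*(1 - A*K))) / (N - 1) = t1*(1-A*N)/?D2 * (1 - p*M*K) + t1 * ?w / ?D2 * (N - K) / (N - 1)"
  proof -
    have "- (A*K*(N - K) + (1 - K)*(1 - A*K)) * ?D2 = (1-A*N) * (1 - p*M*K) * (N - 1) + ?w * (N - K)"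
      unfolding N_def by algebra
    hence "t1 * (- (A*K*(N - K) + (1 - K)*(1 - A*K)) * ?D2) = t1 * ((1-A*N) * (1 - p*M*K) * (N - 1) + ?w * (N - K))"
      by simp
    thus ?thesis using nz(3,5) by (simp add: divide_simps) algebra
  qed
  have "(- A * a + c) * x + (- A * b + d) * y / z = - A * a * x - A * b * y / z + c * x + d * y / z" for a b c d x y z :: 'a
    by (simp add: ring_distribs add_divide_distrib diff_divide_distrib)
  from this show ?thesis unfolding 3 1[symmetric] 2[symmetric] .
qed

text \<open>This is \<open>del_coeff\<close> with all denominators cleared, hence a pure ring
  identity. The left side vanishes at K = 0, which accounts for the factor K on the right.\<close>

lemma del_coeff_poly:
  fixes t1 t2 t3 t4 q M K :: "'a::field"
  defines "A \<equiv> t1*t2" and "B \<equiv> t1*t3" and "C \<equiv> t1*t4" and "p \<equiv> t1*t2*t3*t4" and "N \<equiv> q*M"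
  defines "D1 \<equiv> 1 - p*M^2" and "D2 \<equiv> 1 - p*(q*M^2)" and "D3 \<equiv> 1 - p*(q*M)^2"
  defines "w \<equiv> - 1 - A + p*M + A*N"
  shows "((1 - p*M*K)*(N - K) - N*(1 - B*K)*(1 - C*K)*(A*K*(N - K) + (1 - K)*(1 - A*K))) * (D1 * D2 * D3) =
     K * ((N - 1) * D1 * ((1 - A*N)*(1 - B*N)*(1 - C*N) * (1 - p*N*K) * (1 - p*M*K)
        + N * ((1 - A*N) * (- t1 - t2 + A*(t3 + t4)*N) * (t1*t3*t4) * (N - K) * (1 - p*M*K)))
      + N * D3 * ((- t3 - t4 + (t1 + t2)*t3*t4*M) * w * t1 * (1 - p*M*K) * (N - K)
        - t1 * (1 - t2*t3*M) * (1 - t2*t4*M) * w * (t1*t3*t4) * (M - K) * (N - K)))"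
  unfolding D1_def D2_def D3_def w_def A_def B_def C_def p_def N_def by algebra

lemma del_coeff:
  fixes t1 t2 t3 t4 q M K :: "'a::field"
  defines "A \<equiv> t1*t2" and "B \<equiv> t1*t3" and "C \<equiv> t1*t4" and "p \<equiv> t1*t2*t3*t4" and "N \<equiv> q*M"
  assumes nz: "t1 \<noteq> 0" "q \<noteq> 0" "M \<noteq> 0" "K \<noteq> 0"
    "1 - p*M^2 \<noteq> 0" "1 - p*(q*M^2) \<noteq> 0" "1 - p*(q*M)^2 \<noteq> 0" "N - 1 \<noteq> 0"
  shows "((1 - p*M*K)*(N - K) - N*(1 - B*K)*(1 - C*K)*(A*K*(N - K) + (1 - K)*(1 - A*K))) / (N*K*(N - 1)) =
     ((1 - A*N)*(1 - B*N)*(1 - C*N) / (t1 * (1 - p*(q*M^2)) * (1 - p*(q*M)^2))) * (t1 / N) * (1 - p*N*K) * (1 - p*M*K)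
     + (M * (- t3 - t4 + (t1 + t2)*t3*t4*M) * (- 1 - A + p*M + A*N) / ((1 - p*M^2) * (1 - p*(q*M^2)))) * (t1 / M) * (1 - p*M*K) * (N - K) / (N - 1)
     - (- ((1 - A*N) * (- t1 - t2 + A*(t3 + t4)*N) / ((1 - p*(q*M^2)) * (1 - p*(q*M)^2)))) * (t1*t3*t4) * (N - K) * (1 - p*M*K)
     - (t1 * (1 - t2*t3*M) * (1 - t2*t4*M) * (- 1 - A + p*M + A*N) / ((1 - p*M^2) * (1 - p*(q*M^2)))) * (t1*t3*t4) * (M - K) * (N - K) / (N - 1)"
    (is "?P / (N*K*(N - 1)) = ?a + ?b - ?c - ?d")
proof -
  define D1 where "D1 = 1 - p*M^2"
  define D2 where "D2 = 1 - p*(q*M^2)"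
  define D3 where "D3 = 1 - p*(q*M)^2"
  define w where "w = - 1 - A + p*M + A*N"
  note D = D1_def[symmetric] D2_def[symmetric] D3_def[symmetric] w_def[symmetric]
  have N: "N \<noteq> 0" using nz by (simp add: N_def)
  have D0: "D1 \<noteq> 0" "D2 \<noteq> 0" "D3 \<noteq> 0" using nz by (auto simp: D1_def D2_def D3_def)
  \<comment> \<open>The four numerators become atoms, so clearing denominators is linear in them and
    expands none of these products.\<close>
  define u where "u = (1 - A*N)*(1 - B*N)*(1 - C*N) * (1 - p*N*K) * (1 - p*M*K)"
  define v where "v = (- t3 - t4 + (t1 + t2)*t3*t4*M) * w * t1 * (1 - p*M*K) * (N - K)"
  define x where "x = (1 - A*N) * (- t1 - t2 + A*(t3 + t4)*N) * (t1*t3*t4) * (N - K) * (1 - p*M*K)"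
  define y where "y = t1 * (1 - t2*t3*M) * (1 - t2*t4*M) * w * (t1*t3*t4) * (M - K) * (N - K)"
  have poly: "?P * (D1*D2*D3) = K * ((N - 1) * D1 * (u + N * x) + N * D3 * (v - y))"
    using del_coeff_poly[of t1 t2 t3 t4 M K q]
    unfolding u_def v_def x_def y_def D1_def D2_def D3_def w_def A_def B_def C_def p_def N_def .
  have "?P / (N*K*(N - 1)) = (?P * (D1*D2*D3)) / (N*K*(N - 1) * (D1*D2*D3))"
    using D0 by simp
  also have "\<dots> = u / (D2*D3*N) + v / (D1*D2*(N - 1)) + x / (D2*D3) - y / (D1*D2*(N - 1))"
    unfolding poly using D0 N nz(4,8) by (simp add: divide_simps) (simp add: algebra_simps)
  also have "u / (D2*D3*N) = ?a" using nz(1) by (simp add: D u_def)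
  also have "v / (D1*D2*(N - 1)) = ?b" using nz(3) by (simp add: D v_def)
  also have "x / (D2*D3) = - ?c" by (simp add: D x_def)
  also have "y / (D1*D2*(N - 1)) = ?d" by (simp add: D y_def)
  finally show ?thesis by simp
qed

section \<open>q-Pochhammer symbols, terminating series and index shifts\<close>

lemma qpoch_0 [simp]: "qpoch a q 0 = 1"
  by (simp add: qpoch_def)

lemma qpoch_Suc: "qpoch a q (Suc k) = qpoch a q k * (1 - a * q ^ k)"
  by (simp add: qpoch_def)

text \<open>Both sides are (a;q)_{k+1}, split at its last and at its first factor.\<close>

lemma qpoch_shift: "qpoch a q k * (1 - a * q ^ k) = (1 - a) * qpoch (q * a) q k"
proof (induction k)
  case (Suc k)
  have "qpoch a q (Suc k) * (1 - a * q ^ Suc k) = (qpoch a q k * (1 - a * q ^ k)) * (1 - a * q ^ Suc k)"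
    by (simp only: qpoch_Suc)
  thus ?case unfolding Suc.IH by (simp add: qpoch_Suc mult_ac)
qed simp

lemma qpoch_nonzero: "(\<And>i. 1 - a * q ^ i \<noteq> 0) \<Longrightarrow> qpoch a q k \<noteq> 0"
  by (simp add: qpoch_def)

lemma qpoch_terminates: "q \<noteq> 0 \<Longrightarrow> m < k \<Longrightarrow> qpoch (1 / q ^ m) q k = 0"
  unfolding qpoch_def by (rule prod_zero) auto

text \<open>Any bound L from m on is allowed, so that series of different degrees can be summed over
  one common range.\<close>

lemma phi43_terminating:
  assumes "q \<noteq> 0" "m \<le> L"
  shows "phi43 (1 / q ^ m) a2 a3 a4 b1 b2 b3 q =
    (\<Sum>k\<le>L. (qpoch (1 / q ^ m) q k * qpoch a2 q k * qpoch a3 q k * qpoch a4 q k) /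
            (qpoch q q k * qpoch b1 q k * qpoch b2 q k * qpoch b3 q k) * q ^ k)"
  unfolding phi43_def by (rule suminf_finite) (use assms in \<open>auto simp: qpoch_terminates\<close>)

text \<open>Serves to move contributions at basis index k + 1 back to k; the vanishing end values
  leave no boundary term.\<close>

lemma sum_shift:
  fixes f g :: "nat \<Rightarrow> 'a::comm_ring_1"
  assumes "f 0 = 0" "f (Suc L) = 0"
  shows "(\<Sum>k\<le>L. f (Suc k) * g (Suc k)) = (\<Sum>k\<le>L. f k * g k)"
  using sum.atMost_Suc_shift[of "\<lambda>k. f k * g k" L] assms by simp

section \<open>The basis \<open>gam\<close>, \<open>del\<close> and multiplication by z and
  1/z\<close>

text \<open>Only nonvanishing is recorded, so all algebra stays over the complex field.
  \<open>q_pow\<close> concerns q^(k+1), since 1 - q^0 is zero.\<close>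

locale askey_wilson_parameters =
  fixes q t1 t2 t3 t4 z :: complex
  assumes q: "q \<noteq> 0" and z: "z \<noteq> 0" and t1: "t1 \<noteq> 0"
    and q_pow: "\<And>k. 1 - q * q ^ k \<noteq> 0"
    and t12: "\<And>k. 1 - t1*t2 * q ^ k \<noteq> 0"
    and t13: "\<And>k. 1 - t1*t3 * q ^ k \<noteq> 0"
    and t14: "\<And>k. 1 - t1*t4 * q ^ k \<noteq> 0"
    and t1234: "\<And>k. 1 - t1*t2*t3*t4 * q ^ k \<noteq> 0"
begin

text \<open>In the chain gam 0, z * del 0, gam 1, z * del 1, ... each member gains one factor,
  alternately linear in z and in 1/z. This is what makes multiplication by z or 1/z local.\<close>

definition gam where "gam k = qpoch (t1 * z) q k * qpoch (q * t1 / z) q k"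
definition del where "del k = qpoch (t1 * z) q (Suc k) * qpoch (q * t1 / z) q k / z"

definition hyp where
  "hyp a b k = qpoch a q k * qpoch b q k /
     (qpoch q q k * qpoch (t1*t2) q k * qpoch (t1*t3) q k * qpoch (t1*t4) q k) * q ^ k"

definition E where "E m = hyp (1 / q ^ m) (t1*t2*t3*t4 * q ^ m)"
definition r where "r m = hyp (1 / q ^ Suc m) (t1*t2*t3*t4 * q ^ m)"
definition s where
  "s m k = qpoch (1 / q ^ m) q k * qpoch (t1*t2*t3*t4 * q ^ Suc m) q k /
     (qpoch q q k * qpoch (q*t1*t2) q k * qpoch (q*t1*t3) q k * qpoch (q*t1*t4) q k) * q ^ k"

definition e where "e = (1 - t1*t2) * (1 - t1*t3) * (1 - t1*t4)"

text \<open>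
  \<open>Rc m\<close> and \<open>Sc m\<close> are \<open>R\<^sub>m\<^sub>+\<^sub>1\<close> and \<open>S\<^sub>m\<^sub>+\<^sub>1\<close>, with terms \<open>r m\<close> and \<open>s m\<close>. The shifted index avoids
  \<open>R\<^sub>0\<close>, whose relation to \<open>E 0\<close> involves \<open>1 - t\<^sub>1t\<^sub>2t\<^sub>3t\<^sub>4/q\<close>, which may vanish.
\<close>

definition Rc where
  "Rc m = phi43 (1 / q ^ Suc m) (t1*t2*t3*t4 * q ^ m) (t1 * z) (t1 / z) (t1*t2) (t1*t3) (t1*t4) q"
definition Sc where
  "Sc m = z * (1 - t3 / z) * (1 - t4 / z) *
     phi43 (1 / q ^ m) (t1*t2*t3*t4 * q ^ Suc m) (t1 * z) (q * t1 / z) (q*t1*t2) (q*t1*t3) (q*t1*t4) q"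

lemma q_pow_ne_1: "q ^ Suc m - 1 \<noteq> 0"
  using q_pow[of m] by auto

lemma gam_Suc: "gam (Suc k) = z * del k * (1 - q * q ^ k * t1 / z)"
  using z by (simp add: gam_def del_def qpoch_Suc mult_ac)

lemma z_del: "z * del k = gam k * (1 - t1 * z * q ^ k)"
  using z by (simp add: gam_def del_def qpoch_Suc mult_ac)

lemma z_del': "z * del k = gam (Suc k) + t1 * q * q ^ k * del k"
  unfolding gam_Suc using z by (simp add: field_simps)

lemma gam_div_z: "gam k / z = del k + t1 * q ^ k * gam k"
  using z_del[of k] z by (simp add: field_simps)

text \<open>Dividing \<open>z_del'\<close> by z gives a linear equation for
  \<open>del k / z\<close>; its other quotient, \<open>gam (Suc k) / z\<close>, is known from
  \<open>gam_div_z\<close>. Solving it divides by t1.\<close>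

lemma del_div_z: "del k / z = (del k - del (Suc k)) / (t1 * q * q ^ k) - gam (Suc k)"
proof -
  have "del k = gam (Suc k) / z + t1 * q * q ^ k * (del k / z)"
    using z_del'[of k] z by (simp add: field_simps)
  also have "gam (Suc k) / z = del (Suc k) + t1 * q * q ^ k * gam (Suc k)"
    using gam_div_z[of "Suc k"] by (simp add: mult_ac)
  finally show ?thesis using t1 q by (simp add: field_simps)
qed

text \<open>The product on the left is z * del k times 1 - t1/z, while gam (k+1) is z * del k times
  1 - q^(k+1) t1/z; they differ by a multiple of del k. This brings the terms of R into the
  basis.\<close>

lemma alpha_eq:
  "qpoch (t1 * z) q (Suc k) * qpoch (t1 / z) q (Suc k) = gam (Suc k) - t1 * (1 - q * q ^ k) * del k"
proof -
  have "qpoch (t1 / z) q (Suc k) = (1 - t1 / z) * qpoch (q * t1 / z) q k"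
    using qpoch_shift[of "t1 / z" q k] by (simp add: qpoch_Suc)
  hence "qpoch (t1 * z) q (Suc k) * qpoch (t1 / z) q (Suc k) = z * del k * (1 - t1 / z)"
    using z by (simp add: del_def)
  also have "\<dots> = z * del k - t1 * del k" using z by (simp add: field_simps)
  finally show ?thesis unfolding z_del' by (simp add: algebra_simps)
qed

text \<open>The prefactor of S is z - (t3 + t4) + t3 t4/z. Expanding z * gam k in the basis produces
  1/t1, which the extra t1 removes; the three contributions to gam k then factor.\<close>

lemma gam_prefactor:
  "t1 * (z * (1 - t3 / z) * (1 - t4 / z)) * gam k =
    (1 - t1*t3*q^k) * (1 - t1*t4*q^k) / q^k * gam k - gam (Suc k) / q^k - (q - t3*t4) * t1 * del k"
proof -
  have "z * (1 - t3 / z) * (1 - t4 / z) * gam k = z * gam k - (t3 + t4) * gam k + t3 * t4 * (gam k / z)"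
    using z by (simp add: field_simps)
  also have "gam k / z = del k + t1 * q ^ k * gam k" by (rule gam_div_z)
  also have "t1 * (z * gam k - (t3 + t4) * gam k + t3 * t4 * (del k + t1 * q ^ k * gam k))
     = (1 - t1*t3*q^k) * (1 - t1*t4*q^k) / q^k * gam k - gam (Suc k) / q^k - (q - t3*t4) * t1 * del k"
  proof -
    have gam_Suc_eq: "gam (Suc k) = gam k * (1 - t1 * z * q ^ k) - t1 * q * q ^ k * del k"
      using z_del[of k] z_del'[of k] by (simp add: algebra_simps)
    show ?thesis unfolding gam_Suc_eq using q by (simp add: field_simps)
  qed
  finally show ?thesis by (simp only: mult.assoc)
qed

section \<open>Contiguous relations between the hypergeometric terms\<close>

lemma denominators:
  "qpoch q q k \<noteq> 0" "qpoch (t1*t2) q k \<noteq> 0" "qpoch (t1*t3) q k \<noteq> 0" "qpoch (t1*t4) q k \<noteq> 0"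
  using q_pow t12 t13 t14 by (auto intro!: qpoch_nonzero)

lemma e_nonzero: "1 - t1*t2 \<noteq> 0" "1 - t1*t3 \<noteq> 0" "1 - t1*t4 \<noteq> 0"
  using t12[of 0] t13[of 0] t14[of 0] by auto

lemma hyp_Suc:
  "hyp a b (Suc k) * (1 - q * q^k) * ((1 - t1*t2*q^k) * (1 - t1*t3*q^k) * (1 - t1*t4*q^k)) =
     q * (1 - a * q^k) * (1 - b * q^k) * hyp a b k"
  unfolding hyp_def qpoch_Suc using denominators[of k] q_pow[of k] t12[of k] t13[of k] t14[of k]
  by (simp add: divide_simps)

lemma hyp_shift1: "hyp a b k * (1 - a * q ^ k) = (1 - a) * hyp (q * a) b k"
  using qpoch_shift[of a q k] by (simp add: hyp_def divide_simps mult_ac)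

lemma hyp_shift2: "hyp a b k * (1 - b * q ^ k) = (1 - b) * hyp a (q * b) k"
  using qpoch_shift[of b q k] by (simp add: hyp_def divide_simps mult_ac)

text \<open>\<open>r m\<close> has the first upper parameter of \<open>E (Suc m)\<close> and the
  second of \<open>E m\<close>, so one q-shift leads to either; \<open>r_E_Suc\<close> is the other
  case.\<close>

lemma r_E: "r m k * (q ^ Suc m - q ^ k) = (q ^ Suc m - 1) * E m k"
proof -
  have "r m k * (1 - 1 / q ^ Suc m * q ^ k) = (1 - 1 / q ^ Suc m) * E m k"
    using hyp_shift1[of "1 / q ^ Suc m"] q unfolding r_def E_def by simp
  thus ?thesis using q by (simp add: field_simps)
qed

lemma r_E_Suc:
  "r m k * (1 - t1*t2*t3*t4 * q ^ m * q ^ k) = (1 - t1*t2*t3*t4 * q ^ m) * E (Suc m) k"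
  using hyp_shift2[of _ "t1*t2*t3*t4 * q ^ m"] unfolding r_def E_def by (simp add: mult_ac)

text \<open>For j = 2, 3, 4, shifting the lower parameter t1 tj by q multiplies its Pochhammer
  symbol by (1 - t1 tj q^k)/(1 - t1 tj); the constants collect in \<open>e\<close>.\<close>

lemma s_hyp:
  "s m k * ((1 - t1*t2*q^k) * (1 - t1*t3*q^k) * (1 - t1*t4*q^k)) =
     e * hyp (1 / q ^ m) (t1*t2*t3*t4 * q ^ Suc m) k"
proof -
  note sh = qpoch_shift[of "t1*t2" q k] qpoch_shift[of "t1*t3" q k] qpoch_shift[of "t1*t4" q k]
  have eqs: "qpoch (q*t1*t2) q k = qpoch (t1*t2) q k * (1 - t1*t2*q^k) / (1 - t1*t2)"
    "qpoch (q*t1*t3) q k = qpoch (t1*t3) q k * (1 - t1*t3*q^k) / (1 - t1*t3)"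
    "qpoch (q*t1*t4) q k = qpoch (t1*t4) q k * (1 - t1*t4*q^k) / (1 - t1*t4)"
    using e_nonzero unfolding sh by (simp_all add: mult_ac)
  show ?thesis
    unfolding s_def hyp_def eqs e_def
    using denominators[of k] e_nonzero t12[of k] t13[of k] t14[of k]
    by (simp add: divide_simps)
qed

text \<open>Opposite mixture to \<open>r m\<close>: apart from lower parameters, \<open>s m\<close>
  has the first upper parameter of \<open>E m\<close> and the second of
  \<open>E (Suc m)\<close>.\<close>

lemma s_E:
  "s m k * ((1 - t1*t2*q^k) * (1 - t1*t3*q^k) * (1 - t1*t4*q^k)) * (1 - t1*t2*t3*t4 * q ^ m) =
     e * E m k * (1 - t1*t2*t3*t4 * q ^ m * q ^ k)"
  using hyp_shift2[of "1 / q ^ m" "t1*t2*t3*t4 * q ^ m" k] unfolding s_hyp E_def by (simp add: mult_ac)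

lemma s_E_Suc:
  "s m k * ((1 - t1*t2*q^k) * (1 - t1*t3*q^k) * (1 - t1*t4*q^k)) * (q ^ Suc m - 1) =
     e * E (Suc m) k * (q ^ Suc m - q ^ k)"
proof -
  have "E (Suc m) k * (1 - 1 / q ^ Suc m * q ^ k) =
      (1 - 1 / q ^ Suc m) * hyp (1 / q ^ m) (t1*t2*t3*t4 * q ^ Suc m) k"
    using hyp_shift1[of "1 / q ^ Suc m"] q unfolding E_def by simp
  hence "E (Suc m) k * (q ^ Suc m - q ^ k) =
      (q ^ Suc m - 1) * hyp (1 / q ^ m) (t1*t2*t3*t4 * q ^ Suc m) k"
    using q by (simp add: field_simps)
  thus ?thesis unfolding s_hyp by (simp add: mult_ac)
qed

lemma r_Suc:
  "r m (Suc k) * (1 - q * q^k) * ((1 - t1*t2*q^k) * (1 - t1*t3*q^k) * (1 - t1*t4*q^k)) * q ^ Suc m =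
     q * (q ^ Suc m - q^k) * (1 - t1*t2*t3*t4 * q^m * q^k) * r m k"
  unfolding r_def hyp_Suc using q by (simp add: field_simps)

text \<open>Ties term k + 1 of R_{m+1} to term k of S_{m+1}, so that index shifts in either
  expansion can be undone. \<open>r_Suc\<close> lowers the index, \<open>r_E\<close> and
  \<open>s_E\<close> pass through \<open>E m k\<close>, and the lower factors \<open>?D\<close>
  cancel.\<close>

lemma r_Suc_s:
  "e * r m (Suc k) * (1 - q * q^k) * q ^ Suc m = q * (q ^ Suc m - 1) * (1 - t1*t2*t3*t4 * q^m) * s m k"
proof -
  let ?D = "(1 - t1*t2*q^k) * (1 - t1*t3*q^k) * (1 - t1*t4*q^k)"
  have "(e * r m (Suc k) * (1 - q * q^k) * q ^ Suc m) * ?D = e * (r m (Suc k) * (1 - q * q^k) * ?D * q ^ Suc m)"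
    by (simp only: mult_ac)
  also have "\<dots> = q * e * (1 - t1*t2*t3*t4 * q^m * q^k) * (r m k * (q ^ Suc m - q^k))"
    unfolding r_Suc by (simp only: mult_ac)
  also have "\<dots> = q * (q ^ Suc m - 1) * (e * E m k * (1 - t1*t2*t3*t4 * q^m * q^k))"
    unfolding r_E by (simp only: mult_ac)
  also have "\<dots> = (q * (q ^ Suc m - 1) * (1 - t1*t2*t3*t4 * q^m) * s m k) * ?D"
    unfolding s_E[symmetric] by (simp only: mult_ac)
  finally show ?thesis using t12[of k] t13[of k] t14[of k] by simp
qed

section \<open>Expansions of R and S in the basis\<close>

lemma r_terminates: "Suc m < k \<Longrightarrow> r m k = 0"
  using qpoch_terminates[of q "Suc m" k] q by (simp add: r_def hyp_def)

lemma Rc_eq: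
  assumes "Suc m \<le> L"
  shows "Rc m = (\<Sum>k\<le>L. r m k * gam k - t1 * r m (Suc k) * (1 - q * q^k) * del k)"
proof -
  \<comment> \<open>At k = 0 the product is 1 = gam 0, so no correction arises;
    \<open>alpha_eq\<close> covers k > 0.\<close>
  define h where "h k = (if k = 0 then 0 else t1 * (1 - q^k) * del (k - 1))" for k
  have alpha: "qpoch (t1 * z) q k * qpoch (t1 / z) q k = gam k - h k" for k
    by (cases k) (use alpha_eq in \<open>simp_all add: h_def gam_def\<close>)
  have "Rc m = (\<Sum>k\<le>L. r m k * (qpoch (t1 * z) q k * qpoch (t1 / z) q k))"
    unfolding Rc_def phi43_terminating[OF q assms] r_def hyp_def by (simp add: mult_ac)
  \<comment> \<open>\<open>r m 0\<close> is 1, so the coefficient is set to 0 at k = 0, where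
    \<open>h\<close> vanishes anyway, to meet the boundary condition of
    \<open>sum_shift\<close>.\<close>
  also have "\<dots> = (\<Sum>k\<le>L. r m k * gam k) - (\<Sum>k\<le>L. (if k = 0 then 0 else r m k) * h k)"
    unfolding alpha right_diff_distrib sum_subtractf by (intro arg_cong2[of _ _ _ _ "(-)"] refl sum.cong) (auto simp: h_def)
  also have "(\<Sum>k\<le>L. (if k = 0 then 0 else r m k) * h k) = (\<Sum>k\<le>L. r m (Suc k) * h (Suc k))"
    by (subst sum_shift[symmetric]) (use assms in \<open>auto simp: r_terminates\<close>)
  finally show ?thesis by (simp add: h_def sum_subtractf mult_ac)
qed

text \<open>The gam (k+1) part of \<open>gam_prefactor\<close> is shifted back to index k. For k >
  0, \<open>v k\<close> is s m (k-1) / q^(k-1), rewritten by \<open>r_Suc_s\<close> so that the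
  formula also gives 0 at k = 0.\<close>

lemma Sc_eq:
  assumes "Suc m \<le> L"
  defines "v \<equiv> \<lambda>k. e * r m k * (1 - q^k) * q ^ Suc m / ((q ^ Suc m - 1) * (1 - t1*t2*t3*t4 * q^m) * q^k)"
  shows "t1 * Sc m = (\<Sum>k\<le>L. (s m k * (1 - t1*t3*q^k) * (1 - t1*t4*q^k) / q^k - v k) * gam k - (q - t3*t4) * t1 * s m k * del k)"
proof -
  have v: "v (Suc k) = s m k / q^k" for k
    unfolding v_def using r_Suc_s[of m k] q q_pow_ne_1[of m] t1234[of m] by (simp add: divide_simps mult_ac)
  have v0: "v 0 = 0" "v (Suc L) = 0"
    unfolding v_def using assms by (simp_all add: r_terminates)
  have "t1 * Sc m = t1 * (z * (1 - t3 / z) * (1 - t4 / z)) * (\<Sum>k\<le>L. s m k * gam k)"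
    unfolding Sc_def using assms by (subst phi43_terminating[of q m L]) (auto simp: q s_def gam_def mult_ac)
  also have "\<dots> = (\<Sum>k\<le>L. s m k * (t1 * (z * (1 - t3 / z) * (1 - t4 / z)) * gam k))"
    by (simp add: sum_distrib_left mult_ac)
  also have "\<dots> = (\<Sum>k\<le>L. (s m k * (1 - t1*t3*q^k) * (1 - t1*t4*q^k) / q^k) * gam k
      - (q - t3*t4) * t1 * s m k * del k) - (\<Sum>k\<le>L. v (Suc k) * gam (Suc k))"
    unfolding gam_prefactor v sum_subtractf[symmetric] by (intro sum.cong) (auto simp: algebra_simps)
  also have "(\<Sum>k\<le>L. v (Suc k) * gam (Suc k)) = (\<Sum>k\<le>L. v k * gam k)"
    using v0 by (rule sum_shift)
  finally show ?thesis by (simp add: sum_subtractf left_diff_distrib)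
qed

section \<open>Factored expansions of X and Y\<close>

text \<open>The divisions lengthen lower symbols from k to k + 1 factors: that of t1 t2 in
  \<open>ev\<close>, all three in \<open>fv\<close>. \<open>ev\<close> serves the gam coefficients
  and \<open>fv\<close> the del coefficients.\<close>

definition ev where "ev m k = E m k / (1 - t1*t2*q^k)"
definition fv where "fv m k = E m k / ((1 - t1*t2*q^k) * (1 - t1*t3*q^k) * (1 - t1*t4*q^k))"

lemma s_fv:
  "s m k * (1 - t1*t2*t3*t4 * q ^ m) = e * fv m k * (1 - t1*t2*t3*t4 * q ^ m * q ^ k)"
  "s m k * (q ^ Suc m - 1) = e * fv (Suc m) k * (q ^ Suc m - q ^ k)"
  using s_E[of m k] s_E_Suc[of m k] t12[of k] t13[of k] t14[of k] unfolding fv_def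
  by (simp_all add: divide_simps) (simp_all add: mult_ac)

lemma fv_ev: "fv m k * (1 - t1*t3*q^k) * (1 - t1*t4*q^k) = ev m k"
  using t12[of k] t13[of k] t14[of k] unfolding fv_def ev_def by simp

text \<open>The common factor 1 - t3 t4 M appears twice: from (1 - t1 t2 K) - (1 - p M K) in the gam
  part, and from q - t3 t4 - q (N - 1)/N in the del part.\<close>

lemma X_eq:
  assumes "Suc m \<le> L"
  shows "e * Rc m - t1 * (1 - t1*t2*t3*t4 * q^m) * Sc m = (1 - t3*t4*q^m) * e *
    (\<Sum>k\<le>L. t1 / q^m * (1 - t1*t2*t3*t4 * q^m * q^k) * fv m k * del k - t1*t2 * ev m k * gam k)"
proof -
  define M where "M = q ^ m"
  define N where "N = q ^ Suc m"
  have N: "N = q * M" by (simp add: M_def N_def)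
  have nz: "M \<noteq> 0" "N \<noteq> 0" "N - 1 \<noteq> 0" "1 - t1*t2*t3*t4*M \<noteq> 0"
    using q q_pow_ne_1[of m] t1234[of m] by (simp_all add: M_def N_def)
  define p where "p = t1*t2*t3*t4"
  let ?v = "\<lambda>k. e * r m k * (1 - q^k) * N / ((N - 1) * (1 - p * M) * q^k)"
  have g: "e * r m k - (1 - p * M) * (s m k * (1 - t1*t3*q^k) * (1 - t1*t4*q^k) / q^k - ?v k)
     = (1 - t3*t4*M) * e * (- (t1*t2 * ev m k))" for k
  proof -
    define K where "K = q ^ k"
    have K: "K \<noteq> 0" "1 - t1*t2*K \<noteq> 0" using q t12[of k] by (simp_all add: K_def)
    have E: "E m k = ev m k * (1 - t1*t2*K)" using K by (simp add: ev_def K_def)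
    have "(1 - p * M) * (s m k * (1 - t1*t3*K) * (1 - t1*t4*K)) = e * (1 - p*M*K) * ev m k"
      using s_fv(1)[of m k] fv_ev[of m k] unfolding M_def[symmetric] K_def[symmetric] p_def[symmetric] by algebra
    note S = this
    have "r m k * (N - K) = (N - 1) * ev m k * (1 - t1*t2*K)"
      using r_E[of m k] unfolding N_def[symmetric] K_def[symmetric] E by simp
    \<comment> \<open>The correction \<open>?v\<close> merges with \<open>r m k\<close> into r m k
      (N - K)/((N - 1) K), which is E m k / K by \<open>r_E\<close>.\<close>
    hence "e * r m k + (1 - p * M) * ?v k = e * ev m k * (1 - t1*t2*K) / K"
      using K nz unfolding K_def[symmetric] p_def[symmetric] by (simp add: divide_simps) algebra
    note V = this
    have comb: "a - b * (c / K - w) = a + b * w - b * c / K" for a b c w :: complex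
      by (simp add: right_diff_distrib)
    have "e * r m k - (1 - p * M) * (s m k * (1 - t1*t3*K) * (1 - t1*t4*K) / K - ?v k)
       = e * ev m k * (1 - t1*t2*K) / K - e * (1 - p*M*K) * ev m k / K"
      by (simp only: comb S V)
    also have "\<dots> = (1 - t3*t4*M) * e * (- (t1*t2 * ev m k))"
      using K by (simp add: p_def field_simps)
    finally show ?thesis by (simp add: K_def)
  qed
  have d: "- e * (t1 * r m (Suc k) * (1 - q * q^k)) + (1 - p * M) * ((q - t3*t4) * t1 * s m k)
     = (1 - t3*t4*M) * e * (t1 / M * (1 - p * M * q^k) * fv m k)" for k
  proof -
    have "N * (e * r m (Suc k) * (1 - q * q^k)) = q * (N - 1) * (s m k * (1 - p * M))"
      using r_Suc_s[of m k] unfolding N_def[symmetric] M_def[symmetric] p_def[symmetric] by (simp add: mult_ac)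
    hence R: "e * r m (Suc k) * (1 - q * q^k) = q * (N - 1) / N * (s m k * (1 - p * M))"
      using nz by (simp add: field_simps)
    have S: "s m k * (1 - p * M) = e * fv m k * (1 - p * M * q^k)"
      using s_fv(1)[of m k] by (simp add: M_def p_def)
    have comb: "(a - b) * t1 * x - t1 * (c * x) = t1 * x * (a - b - c)" for a b c x :: complex
      by (simp add: algebra_simps)
    have "- e * (t1 * r m (Suc k) * (1 - q * q^k)) + (1 - p * M) * ((q - t3*t4) * t1 * s m k)
       = (q - t3*t4) * t1 * (s m k * (1 - p * M)) - t1 * (e * r m (Suc k) * (1 - q * q^k))"
      by (simp add: mult_ac)
    also have "\<dots> = t1 * (e * fv m k * (1 - p * M * q^k)) * (q - t3*t4 - q * (N - 1) / N)"
      unfolding R S by (rule comb)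
    also have "q - t3*t4 - q * (N - 1) / N = (1 - t3*t4*M) / M"
      using nz q unfolding N by (simp add: field_simps)
    finally show ?thesis by (simp add: mult_ac)
  qed
  have comb: "a * (b * g - c * d) - x * (y * g - w * d) = (a * b - x * y) * g + (- a * c + x * w) * d"
    "f * (- b) * g + f * c * d = f * (c * d - b * g)"
    for a b c d f g w x y :: complex
    by (simp_all add: algebra_simps)
  have "e * Rc m - t1 * (1 - p * M) * Sc m = e * Rc m - (1 - p * M) * (t1 * Sc m)" by simp
  also have "\<dots> = (\<Sum>k\<le>L. (e * r m k - (1 - p * M) * (s m k * (1 - t1*t3*q^k) * (1 - t1*t4*q^k) / q^k - ?v k)) * gam k
     + (- e * (t1 * r m (Suc k) * (1 - q * q^k)) + (1 - p * M) * ((q - t3*t4) * t1 * s m k)) * del k)"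
    unfolding Rc_eq[OF assms] Sc_eq[OF assms] N_def[symmetric] M_def[symmetric] p_def[symmetric]
      sum_distrib_left sum_subtractf[symmetric]
    by (intro sum.cong refl) (rule comb)
  also have "\<dots> = (1 - t3*t4*M) * e * (\<Sum>k\<le>L. t1 / M * (1 - p * M * q^k) * fv m k * del k - t1*t2 * ev m k * gam k)"
    unfolding g d sum_distrib_left by (intro sum.cong refl) (rule comb)
  finally show ?thesis by (simp add: M_def p_def)
qed

text \<open>As for \<open>X_eq\<close>, but eliminating towards \<open>E (Suc m)\<close>, using
  \<open>r_E_Suc\<close> and the second part of \<open>s_fv\<close>. The common factor now comes
  from N (1 - t1 t2 K) - (N - K) = K (1 - t1 t2 N).\<close>

lemma Y_eq:
  assumes "Suc m \<le> L"
  shows "q ^ Suc m * e * Rc m + t1 * (1 - q ^ Suc m) * Sc m = (1 - t1*t2*q^Suc m) * e *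
    (\<Sum>k\<le>L. ev (Suc m) k * gam k - t1*t3*t4 * (q^Suc m - q^k) * fv (Suc m) k * del k)"
proof -
  define M where "M = q ^ m"
  define N where "N = q ^ Suc m"
  have N: "N = q * M" by (simp add: M_def N_def)
  have nz: "M \<noteq> 0" "N \<noteq> 0" "N - 1 \<noteq> 0" "1 - t1*t2*t3*t4*M \<noteq> 0"
    using q q_pow_ne_1[of m] t1234[of m] by (simp_all add: M_def N_def)
  define p where "p = t1*t2*t3*t4"
  let ?v = "\<lambda>k. e * r m k * (1 - q^k) * N / ((N - 1) * (1 - p * M) * q^k)"
  have g: "N * e * r m k + (1 - N) * (s m k * (1 - t1*t3*q^k) * (1 - t1*t4*q^k) / q^k - ?v k)
     = (1 - t1*t2*N) * e * ev (Suc m) k" for k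
  proof -
    define K where "K = q ^ k"
    have K: "K \<noteq> 0" "1 - t1*t2*K \<noteq> 0" using q t12[of k] by (simp_all add: K_def)
    have E: "E (Suc m) k = ev (Suc m) k * (1 - t1*t2*K)" using K by (simp add: ev_def K_def)
    have "(1 - N) * (s m k * (1 - t1*t3*K) * (1 - t1*t4*K)) = - e * (N - K) * ev (Suc m) k"
      using s_fv(2)[of m k] fv_ev[of "Suc m" k] unfolding N_def[symmetric] K_def[symmetric] by algebra
    note S = this
    have "r m k * (1 - p*M*K) = (1 - p*M) * ev (Suc m) k * (1 - t1*t2*K)"
      using r_E_Suc[of m k] unfolding M_def[symmetric] K_def[symmetric] p_def[symmetric] E by simp
    hence "N * e * r m k - (1 - N) * ?v k = e * ev (Suc m) k * (1 - t1*t2*K) * N / K"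
      using K nz unfolding K_def[symmetric] p_def[symmetric] by (simp add: divide_simps) algebra
    note V = this
    have comb: "a + b * (c / K - w) = a - b * w + b * c / K" for a b c w :: complex
      by (simp add: right_diff_distrib)
    have "N * e * r m k + (1 - N) * (s m k * (1 - t1*t3*K) * (1 - t1*t4*K) / K - ?v k)
       = e * ev (Suc m) k * (1 - t1*t2*K) * N / K + - e * (N - K) * ev (Suc m) k / K"
      by (simp only: comb S V)
    also have "\<dots> = (1 - t1*t2*N) * e * ev (Suc m) k"
      using K by (simp add: field_simps)
    finally show ?thesis by (simp add: K_def)
  qed
  have d: "- (N * e) * (t1 * r m (Suc k) * (1 - q * q^k)) - (1 - N) * ((q - t3*t4) * t1 * s m k)
     = (1 - t1*t2*N) * e * (- (t1*t3*t4 * (N - q^k) * fv (Suc m) k))" for k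
  proof -
    have R: "N * (e * r m (Suc k) * (1 - q * q^k)) = q * (1 - p * M) * (s m k * (N - 1))"
      using r_Suc_s[of m k] unfolding N_def[symmetric] M_def[symmetric] p_def[symmetric] by (simp add: mult_ac)
    have S: "s m k * (N - 1) = e * fv (Suc m) k * (N - q^k)"
      using s_fv(2)[of m k] by (simp add: N_def)
    have comb: "(a - b) * t1 * x - t1 * (c * x) = t1 * x * (a - b - c)" for a b c x :: complex
      by (simp add: algebra_simps)
    have "- (N * e) * (t1 * r m (Suc k) * (1 - q * q^k)) - (1 - N) * ((q - t3*t4) * t1 * s m k)
       = (q - t3*t4) * t1 * (s m k * (N - 1)) - t1 * (N * (e * r m (Suc k) * (1 - q * q^k)))"
      by (simp add: algebra_simps)
    also have "\<dots> = t1 * (e * fv (Suc m) k * (N - q^k)) * (q - t3*t4 - q * (1 - p * M))"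
      unfolding R S by (rule comb)
    also have "q - t3*t4 - q * (1 - p * M) = - t3 * t4 * (1 - t1*t2*N)"
      unfolding N p_def by (simp add: algebra_simps)
    finally show ?thesis by (simp add: mult_ac)
  qed
  have comb: "a * (b * g - c * d) + x * (y * g - w * d) = (a * b + x * y) * g + (- a * c - x * w) * d"
    "f * b * g + f * (- c) * d = f * (b * g - c * d)"
    for a b c d f g w x y :: complex
    by (simp_all add: algebra_simps)
  have "N * e * Rc m + t1 * (1 - N) * Sc m = N * e * Rc m + (1 - N) * (t1 * Sc m)" by simp
  also have "\<dots> = (\<Sum>k\<le>L. (N * e * r m k + (1 - N) * (s m k * (1 - t1*t3*q^k) * (1 - t1*t4*q^k) / q^k - ?v k)) * gam k
     + (- (N * e) * (t1 * r m (Suc k) * (1 - q * q^k)) - (1 - N) * ((q - t3*t4) * t1 * s m k)) * del k)"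
    unfolding Rc_eq[OF assms] Sc_eq[OF assms] N_def[symmetric] M_def[symmetric] p_def[symmetric]
      sum_distrib_left sum.distrib[symmetric]
    by (intro sum.cong refl) (rule comb)
  also have "\<dots> = (1 - t1*t2*N) * e * (\<Sum>k\<le>L. ev (Suc m) k * gam k - t1*t3*t4 * (N - q^k) * fv (Suc m) k * del k)"
    unfolding g d sum_distrib_left by (intro sum.cong refl) (rule comb)
  finally show ?thesis by (simp add: N_def)
qed

section \<open>The recurrence for the normalized sums\<close>

text \<open>Both degrees m and m + 1 are referred to the single term \<open>r m k\<close>, which can
  then be divided out of the recurrence.\<close>

lemma r_ev:
  "ev m k = r m k / (1 - t1*t2*q^k) * (q ^ Suc m - q^k) / (q ^ Suc m - 1)"
  "ev (Suc m) k = r m k / (1 - t1*t2*q^k) * (1 - t1*t2*t3*t4*q^m*q^k) / (1 - t1*t2*t3*t4*q^m)"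
proof -
  have "E m k = r m k * (q ^ Suc m - q^k) / (q ^ Suc m - 1)"
    using r_E[of m k] q_pow_ne_1[of m] by (simp add: nonzero_eq_divide_eq mult_ac)
  thus "ev m k = r m k / (1 - t1*t2*q^k) * (q ^ Suc m - q^k) / (q ^ Suc m - 1)"
    unfolding ev_def by (simp add: mult_ac)
  have "E (Suc m) k = r m k * (1 - t1*t2*t3*t4*q^m*q^k) / (1 - t1*t2*t3*t4*q^m)"
    using r_E_Suc[of m k] t1234[of m] by (simp add: nonzero_eq_divide_eq mult_ac)
  thus "ev (Suc m) k = r m k / (1 - t1*t2*q^k) * (1 - t1*t2*t3*t4*q^m*q^k) / (1 - t1*t2*t3*t4*q^m)"
    unfolding ev_def by (simp add: mult_ac)
qed

lemma fv_eq: "fv m k = ev m k / ((1 - t1*t3*q^k) * (1 - t1*t4*q^k))"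
  unfolding fv_def ev_def by (simp add: mult_ac)

text \<open>\<open>v\<close> is the sequence \<open>c\<close> delayed by one index. It collects the
  del (k+1) and gam (k+1) contributions of \<open>del_div_z\<close>.\<close>

lemma sum_div_z:
  assumes "v 0 = 0" "v (Suc L) = 0" and v: "\<And>k. v (Suc k) = c k"
  shows "(\<Sum>k\<le>L. c k * del k + g k * gam k) / z =
    (\<Sum>k\<le>L. (g k + c k / (t1 * q * q^k) - v k / (t1 * q^k)) * del k + (t1 * q^k * g k - v k) * gam k)"
proof -
  have "(c k * del k + g k * gam k) / z = (g k + c k / (t1 * q * q^k)) * del k + t1 * q^k * g k * gam k
     - v (Suc k) * (del (Suc k) / (t1 * q ^ Suc k) + gam (Suc k))" for k
  proof -
    have "(c k * del k + g k * gam k) / z = c k * (del k / z) + g k * (gam k / z)"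
      by (simp add: add_divide_distrib)
    thus ?thesis unfolding del_div_z gam_div_z v
      by (simp add: algebra_simps add_divide_distrib diff_divide_distrib)
  qed
  hence "(\<Sum>k\<le>L. c k * del k + g k * gam k) / z =
     (\<Sum>k\<le>L. (g k + c k / (t1 * q * q^k)) * del k + t1 * q^k * g k * gam k)
     - (\<Sum>k\<le>L. v (Suc k) * (del (Suc k) / (t1 * q ^ Suc k) + gam (Suc k)))"
    by (simp only: sum_divide_distrib sum_subtractf)
  also have "(\<Sum>k\<le>L. v (Suc k) * (del (Suc k) / (t1 * q ^ Suc k) + gam (Suc k))) =
      (\<Sum>k\<le>L. v k * (del k / (t1 * q ^ k) + gam k))"
    by (rule sum_shift) fact+
  finally show ?thesis
    by (simp add: sum_subtractf[symmetric] algebra_simps)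
qed

text \<open>Normalizations with different indexing: \<open>Xs L m\<close> belongs to X_{-m-1}, with
  (1 - t3 t4 q^m) e removed, whereas \<open>Ys L m\<close> belongs to Y_m, with (1 - t1 t2 q^m) e
  removed.\<close>

definition Xs where
  "Xs L m = (\<Sum>k\<le>L. t1 / q^m * (1 - t1*t2*t3*t4 * q^m * q^k) * fv m k * del k - t1*t2 * ev m k * gam k)"

definition Ys where
  "Ys L m = (\<Sum>k\<le>L. ev m k * gam k - t1*t3*t4 * (q^m - q^k) * fv m k * del k)"

text \<open>The factor \<open>1 - p*M\<close> stays outside \<open>a\<close> and \<open>c\<close>,
  because it cancels the denominator that \<open>r_ev\<close> gives for degree m + 1.\<close>

lemma recurrence:
  fixes m :: nat
  assumes L: "Suc m \<le> L"
  defines "M \<equiv> q^m" and "N \<equiv> q * q^m" and "A \<equiv> t1*t2" and "B \<equiv> t1*t3" and "C \<equiv> t1*t4" and "p \<equiv> t1*t2*t3*t4"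
  defines "a \<equiv> (1 - A*N)*(1 - B*N)*(1 - C*N) / (t1 * (1 - p*(q*M^2)) * (1 - p*(q*M)^2))"
    and "b \<equiv> M * (- t3 - t4 + (t1 + t2)*t3*t4*M) * (- 1 - A + p*M + A*N) / ((1 - p*M^2) * (1 - p*(q*M^2)))"
    and "c \<equiv> - ((1 - A*N) * (- t1 - t2 + A*(t3 + t4)*N) / ((1 - p*(q*M^2)) * (1 - p*(q*M)^2)))"
    and "d \<equiv> t1 * (1 - t2*t3*M) * (1 - t2*t4*M) * (- 1 - A + p*M + A*N) / ((1 - p*M^2) * (1 - p*(q*M^2)))"
  shows "Xs L m / z = a * (1 - p*M) * Xs L (Suc m) + b * Xs L m + c * (1 - p*M) * Ys L (Suc m) + d * Ys L m"
proof -
  have nz: "M \<noteq> 0" "N \<noteq> 0" "N - 1 \<noteq> 0" "1 - p*M \<noteq> 0"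
    using q q_pow_ne_1[of m] t1234[of m] by (simp_all add: M_def N_def p_def)
  have nz2: "1 - p*M^2 \<noteq> 0" "1 - p*(q*M^2) \<noteq> 0" "1 - p*(q*M)^2 \<noteq> 0"
    using t1234[of "m*2"] t1234[of "Suc (m*2)"] t1234[of "Suc m * 2"]
    by (simp_all add: M_def p_def power_mult power_mult_distrib power2_eq_square mult_ac)
  \<comment> \<open>The delayed del coefficient of \<open>Xs L m\<close>, written through
    \<open>r m k\<close> so that 1 - q^k yields the zero at k = 0.\<close>
  define v where "v k = t1 * r m k * (1 - q^k) / (N - 1)" for k
  have v0: "v 0 = 0" "v (Suc L) = 0"
    unfolding v_def using L by (simp_all add: r_terminates)
  have vS: "v (Suc k) = t1 / M * (1 - p * M * q^k) * fv m k" for k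
  proof -
    have "e * r m (Suc k) * (1 - q * q^k) * N = q * (N - 1) * (e * fv m k * (1 - p * M * q^k))"
      using r_Suc_s[of m k] s_fv(1)[of m k] unfolding M_def N_def p_def by (simp add: mult_ac)
    moreover have "e \<noteq> 0" using e_nonzero by (simp add: e_def)
    ultimately have "r m (Suc k) * (1 - q * q^k) * M = (N - 1) * (fv m k * (1 - p * M * q^k))"
      using q unfolding N_def M_def by (simp add: mult_ac)
    thus ?thesis unfolding v_def using nz by (simp add: divide_simps mult_ac)
  qed
  have gam: "t1 * q^k * (- (A * ev m k)) - v k =
      a * (1 - p*M) * (- (A * ev (Suc m) k)) + b * (- (A * ev m k)) + c * (1 - p*M) * ev (Suc m) k + d * ev m k" for k
  proof -
    define K where "K = q^k"
    \<comment> \<open>The common factor of all gam coefficients; what is left is the identity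
      \<open>gam_coeff\<close> in K.\<close>
    define \<rho> where "\<rho> = r m k / (1 - A*K)"
    have AK: "1 - A*K \<noteq> 0" using t12[of k] by (simp add: A_def K_def)
    have r: "r m k = \<rho> * (1 - A*K)" using AK by (simp add: \<rho>_def)
    have ev: "ev m k = \<rho> * (N - K) / (N - 1)" "ev (Suc m) k = \<rho> * (1 - p*M*K) / (1 - p*M)"
      unfolding r_ev[of m k] \<rho>_def K_def N_def M_def A_def p_def by simp_all
    have "t1 * K * (- (A * ev m k)) - v k = \<rho> * (- (t1 * (A*K*(N - K) + (1 - K)*(1 - A*K))) / (N - 1))"
      unfolding v_def r ev K_def[symmetric] using nz by (simp add: divide_simps) algebra
    also have "- (t1 * (A*K*(N - K) + (1 - K)*(1 - A*K))) / (N - 1) =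
      - A * a * (1 - p*M*K) - A * b * (N - K) / (N - 1) + c * (1 - p*M*K) + d * (N - K) / (N - 1)"
      unfolding a_def b_def c_def d_def using gam_coeff[of t1 t2 t3 t4 M q K] t1 nz nz2
      unfolding A_def B_def C_def p_def N_def M_def by blast
    also have "\<rho> * \<dots> = a * (1 - p*M) * (- (A * ev (Suc m) k)) + b * (- (A * ev m k)) + c * (1 - p*M) * ev (Suc m) k + d * ev m k"
    proof -
      have "(1 - p*M) * ev (Suc m) k = \<rho> * (1 - p*M*K)" unfolding ev using nz by simp
      hence S: "x * (1 - p*M) * ev (Suc m) k = x * (\<rho> * (1 - p*M*K))" for x
        by (simp only: mult.assoc)
      have S': "x * (1 - p*M) * (- (A * ev (Suc m) k)) = - (A * x * (\<rho> * (1 - p*M*K)))" for x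
        using S[of "A * x"] by (simp only: mult_ac mult_minus_right)
      have comb: "\<rho> * (- A * a * x - A * b * y / n + c * x + d * y / n) =
        - (A * a * (\<rho> * x)) + b * (- (A * (\<rho> * y / n))) + c * (\<rho> * x) + d * (\<rho> * y / n)" for x y n :: complex
        by (simp add: algebra_simps)
      show ?thesis unfolding S S' unfolding comb ev(1) ..
    qed
    finally show ?thesis by (simp add: K_def)
  qed
  have del: "- (A * ev m k) + t1 / M * (1 - p * M * q^k) * fv m k / (t1 * q * q^k) - v k / (t1 * q^k) =
      a * (1 - p*M) * (t1 / N * (1 - p * N * q^k) * fv (Suc m) k) + b * (t1 / M * (1 - p * M * q^k) * fv m k)
      + c * (1 - p*M) * (- (t1*t3*t4 * (N - q^k) * fv (Suc m) k)) + d * (- (t1*t3*t4 * (M - q^k) * fv m k))" for k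
  proof -
    define K where "K = q^k"
    \<comment> \<open>The del coefficients contain \<open>fv\<close>, so all three lower factors are
      divided out before \<open>del_coeff\<close> applies.\<close>
    define \<rho> where "\<rho> = r m k / ((1 - A*K) * (1 - B*K) * (1 - C*K))"
    have K: "K \<noteq> 0" "1 - A*K \<noteq> 0" "1 - B*K \<noteq> 0" "1 - C*K \<noteq> 0"
      using q t12[of k] t13[of k] t14[of k] by (simp_all add: A_def B_def C_def K_def)
    have r: "r m k = \<rho> * (1 - A*K) * (1 - B*K) * (1 - C*K)" using K by (simp add: \<rho>_def)
    have fv: "fv m k = \<rho> * (N - K) / (N - 1)" "fv (Suc m) k = \<rho> * (1 - p*M*K) / (1 - p*M)"
      unfolding fv_eq r_ev[of m k] \<rho>_def K_def N_def M_def A_def B_def C_def p_def by (simp_all add: mult_ac)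
    have ev: "ev m k = \<rho> * (N - K) / (N - 1) * (1 - B*K) * (1 - C*K)"
      using fv_ev[of m k] unfolding fv by (simp add: B_def C_def K_def)
    have "- (A * ev m k) + t1 / M * (1 - p * M * K) * fv m k / (t1 * q * K) - v k / (t1 * K) =
      \<rho> * (((1 - p*M*K)*(N - K) - N*(1 - B*K)*(1 - C*K)*(A*K*(N - K) + (1 - K)*(1 - A*K))) / (N*K*(N - 1)))"
    proof -
      define n1 where "n1 = N - 1"
      have "N = q * M" by (simp add: N_def M_def)
      hence c: "t1 / M * (1 - p * M * K) * fv m k / (t1 * q * K) = \<rho> * (1 - p*M*K) * (N - K) / (N*K*n1)"
        unfolding fv n1_def using t1 by (simp add: mult_ac)
      have v: "v k / (t1 * K) = \<rho> * (1 - A*K) * (1 - B*K) * (1 - C*K) * (1 - K) / (n1 * K)"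
        unfolding v_def r K_def[symmetric] n1_def[symmetric] using t1 by simp
      have comb: "- (A * (\<rho> * h / n * x * y)) + \<rho> * w * h / (N * K * n) - \<rho> * s * x * y * u / (n * K) =
        \<rho> * ((w * h - N * x * y * (A * K * h + u * s)) / (N * K * n))" if "n \<noteq> 0" for n h w x y s u
        using nz(2) K(1) that by (simp add: field_simps)
      show ?thesis unfolding c v ev n1_def[symmetric] by (rule comb[OF nz(3)[folded n1_def]])
    qed
    also have "((1 - p*M*K)*(N - K) - N*(1 - B*K)*(1 - C*K)*(A*K*(N - K) + (1 - K)*(1 - A*K))) / (N*K*(N - 1)) =
      a * (t1 / N) * (1 - p*N*K) * (1 - p*M*K) + b * (t1 / M) * (1 - p*M*K) * (N - K) / (N - 1)
      - c * (t1*t3*t4) * (N - K) * (1 - p*M*K) - d * (t1*t3*t4) * (M - K) * (N - K) / (N - 1)"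
      unfolding a_def b_def c_def d_def using del_coeff[of t1 q M K t2 t3 t4] t1 q K(1) nz nz2
      unfolding A_def B_def C_def p_def N_def M_def by blast
    also have "\<rho> * \<dots> = a * (1 - p*M) * (t1 / N * (1 - p * N * K) * fv (Suc m) k) + b * (t1 / M * (1 - p * M * K) * fv m k)
      + c * (1 - p*M) * (- (t1*t3*t4 * (N - K) * fv (Suc m) k)) + d * (- (t1*t3*t4 * (M - K) * fv m k))"
    proof -
      have "(1 - p*M) * fv (Suc m) k = \<rho> * (1 - p*M*K)" unfolding fv using nz by simp
      moreover have "a * (1 - p*M) * (x * fv (Suc m) k) = a * x * ((1 - p*M) * fv (Suc m) k)" for a x
        by (simp only: mult_ac)
      ultimately have S: "a * (1 - p*M) * (x * fv (Suc m) k) = a * x * (\<rho> * (1 - p*M*K))" for a x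
        by simp
      have S': "c * (1 - p*M) * (- (x * fv (Suc m) k)) = - c * x * (\<rho> * (1 - p*M*K))" for c x :: complex
        using S[of c x] by simp
      have comb: "\<rho> * (x + y * w / n - u - s * w / n) = x * \<rho> + y * (\<rho> * w / n) - u * \<rho> - s * (\<rho> * w / n)" for x y u s w n :: complex
        by (simp add: algebra_simps)
      show ?thesis unfolding S S' unfolding comb fv(1) by (simp add: mult_ac)
    qed
    finally show ?thesis by (simp add: K_def)
  qed
  have "Xs L m = (\<Sum>k\<le>L. t1 / M * (1 - p * M * q^k) * fv m k * del k + (- (A * ev m k)) * gam k)"
    unfolding Xs_def M_def p_def A_def by simp
  hence "Xs L m / z = (\<Sum>k\<le>L. (- (A * ev m k) + t1 / M * (1 - p * M * q^k) * fv m k / (t1 * q * q^k) - v k / (t1 * q^k)) * del k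
     + (t1 * q^k * (- (A * ev m k)) - v k) * gam k)"
    by (simp only: sum_div_z[of v, OF v0 vS])
  also have "\<dots> = (\<Sum>k\<le>L. a * (1 - p*M) * (t1 / N * (1 - p * N * q^k) * fv (Suc m) k * del k - A * ev (Suc m) k * gam k)
      + b * (t1 / M * (1 - p * M * q^k) * fv m k * del k - A * ev m k * gam k)
      + c * (1 - p*M) * (ev (Suc m) k * gam k - t1*t3*t4 * (N - q^k) * fv (Suc m) k * del k)
      + d * (ev m k * gam k - t1*t3*t4 * (M - q^k) * fv m k * del k))"
  proof (intro sum.cong refl, goal_cases)
    case (1 k)
    have "(a * x + b * y + c * (- u) + d * (- s)) * D + (a * (- (A * f)) + b * (- (A * h)) + c * f + d * h) * G =
      a * (x * D - A * f * G) + b * (y * D - A * h * G) + c * (f * G - u * D) + d * (h * G - s * D)"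
      for a b c d x y u s f h D G :: complex
      by (simp add: algebra_simps)
    thus ?case unfolding gam del .
  qed
  finally show ?thesis
    unfolding Xs_def Ys_def sum.distrib sum_distrib_left M_def N_def p_def A_def power_Suc .
qed

end

section \<open>Return to the real parameters and the stated coefficients\<close>

theorem proposition4p11:
  fixes q t1 t2 t3 t4 :: real and n :: nat
  assumes "0 < q" and "q < 1"
    and "\<bar>t1\<bar> < 1" and "\<bar>t2\<bar> < 1" and "\<bar>t3\<bar> < 1" and "\<bar>t4\<bar> < 1"
    and "n \<ge> 1" and "t1 \<noteq> 0"
  shows "\<forall>z::complex. z \<noteq> 0 \<longrightarrow>
    1 / z * X_neg q t1 t2 t3 t4 n z =
      of_real (coeff_a q t1 t2 t3 t4 n) * X_neg q t1 t2 t3 t4 (n + 1) z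
      + of_real (coeff_b q t1 t2 t3 t4 n) * X_neg q t1 t2 t3 t4 n z
      + of_real (coeff_c q t1 t2 t3 t4 n) * Y q t1 t2 t3 t4 n z
      + of_real (coeff_d q t1 t2 t3 t4 n) * Y q t1 t2 t3 t4 (n - 1) z"
proof (intro allI impI)
  fix z :: complex assume z: "z \<noteq> 0"
  obtain m where n: "n = Suc m" using \<open>n \<ge> 1\<close> by (cases n) auto
  have nz: "1 - x * q ^ k \<noteq> 0" if "\<bar>x\<bar> < 1" for x :: real and k
  proof -
    have "\<bar>x * q ^ k\<bar> \<le> \<bar>x\<bar> * 1"
      unfolding abs_mult using assms by (intro mult_left_mono) (auto simp: power_le_one)
    thus ?thesis using that by auto
  qed
  have prod: "\<bar>x * y\<bar> < 1" if "\<bar>x\<bar> < 1" "\<bar>y\<bar> < 1" for x y :: real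
    using mult_strict_mono'[of "\<bar>x\<bar>" 1 "\<bar>y\<bar>" 1] that by (simp add: abs_mult)
  have nzc: "1 - of_real x * of_real q ^ k \<noteq> (0::complex)" if "\<bar>x\<bar> < 1" for x k
  proof -
    have "of_real (1 - x * q ^ k) \<noteq> (0::complex)" using nz[OF that] by (simp only: of_real_eq_0_iff not_False_eq_True)
    thus ?thesis by simp
  qed
  interpret askey_wilson_parameters "of_real q" "of_real t1" "of_real t2" "of_real t3" "of_real t4" z
  proof
    fix k
    show "1 - complex_of_real q * complex_of_real q ^ k \<noteq> 0"
      by (rule nzc) (use assms in auto)
    show "1 - complex_of_real t1 * complex_of_real t2 * complex_of_real q ^ k \<noteq> 0"
      using nzc[of "t1*t2" k] prod assms by simp
    show "1 - complex_of_real t1 * complex_of_real t3 * complex_of_real q ^ k \<noteq> 0"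
      using nzc[of "t1*t3" k] prod assms by simp
    show "1 - complex_of_real t1 * complex_of_real t4 * complex_of_real q ^ k \<noteq> 0"
      using nzc[of "t1*t4" k] prod assms by simp
    show "1 - complex_of_real t1 * complex_of_real t2 * complex_of_real t3 * complex_of_real t4 * complex_of_real q ^ k \<noteq> 0"
      using nzc[of "t1*t2*t3*t4" k] prod assms by simp
  qed (use assms z in auto)
  have R: "R q t1 t2 t3 t4 (Suc j) z = Rc j" for j
  proof -
    have "q powi - int (Suc j) = 1 / q ^ Suc j"
      by (simp only: power_int_minus power_int_of_nat inverse_eq_divide)
    thus ?thesis unfolding R_def Rc_def by simp
  qed
  have S: "S q t1 t2 t3 t4 (Suc j) z = Sc j" for j
    unfolding S_def Sc_def by (simp add: power_int_minus divide_inverse)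
  have e: "complex_of_real ((1 - t1*t2) * (1 - t1*t3) * (1 - t1*t4)) = e"
    by (simp add: e_def)
  \<comment> \<open>Large enough for X_{-n-1} = X_{-(m+2)}, the highest degree that occurs.\<close>
  define L where "L = m + 2"
  have X: "X_neg q t1 t2 t3 t4 (Suc j) z = (1 - of_real (t3*t4*q^j)) * e * Xs L j" if "Suc j \<le> L" for j
    using X_eq[OF that] unfolding X_neg_def R S e Xs_def by simp
  have Y_Suc: "Y q t1 t2 t3 t4 (Suc j) z = (1 - of_real (t1*t2*q^Suc j)) * e * Ys L (Suc j)" if "Suc j \<le> L" for j
    using Y_eq[OF that] unfolding Y_def R S Ys_def by (simp add: e_def mult_ac)
  \<comment> \<open>\<open>Y_eq\<close> starts at Y_1, so Y_0 is computed directly: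
    \<open>E 0\<close> lives only at k = 0, where q^0 - q^k kills the del term, and both sides equal
    \<open>e\<close>.\<close>
  have Y_0: "Y q t1 t2 t3 t4 0 z = (1 - of_real (t1*t2*q^0)) * e * Ys L 0"
  proof -
    have "E 0 k = 0" if "k \<noteq> 0" for k
      using qpoch_terminates[of "of_real q" 0 k] that assms by (simp add: E_def hyp_def)
    hence "Ys L 0 = (\<Sum>k\<in>{0}. ev 0 k * gam k)"
      unfolding Ys_def by (intro sum.mono_neutral_cong_right) (auto simp: ev_def fv_def)
    also have "\<dots> = 1 / (1 - t1*t2)"
      by (simp add: ev_def E_def hyp_def gam_def)
    finally have "(1 - of_real (t1*t2*q^0)) * e * Ys L 0 = e"
      using e_nonzero by simp
    moreover have "R q t1 t2 t3 t4 0 z = 1"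
      unfolding R_def using phi43_terminating[of "of_real q" 0 0] assms by simp
    ultimately show ?thesis unfolding Y_def by (simp add: e_def)
  qed
  have Y: "Y q t1 t2 t3 t4 j z = (1 - of_real (t1*t2*q^j)) * e * Ys L j" if "j \<le> L" for j
    by (cases j) (use that Y_0 Y_Suc in auto)
  define M where "M = q ^ m"
  define N where "N = q * M"
  define p where "p = t1*t2*t3*t4"
  define a where "a = (1 - t1*t2*N)*(1 - t1*t3*N)*(1 - t1*t4*N) / (t1 * (1 - p*(q*M^2)) * (1 - p*(q*M)^2))"
  define b where "b = M * (- t3 - t4 + (t1 + t2)*t3*t4*M) * (- 1 - t1*t2 + p*M + t1*t2*N) / ((1 - p*M^2) * (1 - p*(q*M^2)))"
  define c where "c = - ((1 - t1*t2*N) * (- t1 - t2 + t1*t2*(t3 + t4)*N) / ((1 - p*(q*M^2)) * (1 - p*(q*M)^2)))"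
  define d where "d = t1 * (1 - t2*t3*M) * (1 - t2*t4*M) * (- 1 - t1*t2 + p*M + t1*t2*N) / ((1 - p*M^2) * (1 - p*(q*M^2)))"
  have pows: "q powi (int n - 1) = M" "q ^ n = N" "q ^ (2 * n) = (q*M)^2"
    "q powi (2 * int n - 2) = M^2" "q powi (2 * int n - 1) = q*M^2"
  proof -
    have "2 * int n - 2 = int (m * 2)" "2 * int n - 1 = int (Suc (m * 2))" by (simp_all add: n)
    thus "q powi (2 * int n - 2) = M^2" "q powi (2 * int n - 1) = q*M^2"
      by (simp_all only: power_int_of_nat power_mult M_def power_Suc)
    show "q ^ (2 * n) = (q*M)^2"
      unfolding n M_def power_Suc[symmetric] by (simp only: power_mult[symmetric] mult.commute)
  qed (simp_all add: n M_def N_def)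
  have nzM: "1 - t3*t4*N \<noteq> 0" "1 - t1*t2*M \<noteq> 0"
    using nz[of "t3*t4" "Suc m"] nz[of "t1*t2" m] prod assms by (simp_all add: M_def N_def)
  \<comment> \<open>The stated coefficients are those of \<open>recurrence\<close> times the ratio
    of the factors removed in \<open>Xs\<close> and \<open>Ys\<close>. For \<open>coeff_b\<close>
    this ratio is 1; in \<open>coeff_c\<close> its denominator cancels against a factor of
    \<open>c\<close>.\<close>
  have coeffs: "coeff_a q t1 t2 t3 t4 n * (1 - t3*t4*N) = (1 - t3*t4*M) * (a * (1 - p*M))"
    "coeff_b q t1 t2 t3 t4 n = b"
    "coeff_c q t1 t2 t3 t4 n * (1 - t1*t2*N) = (1 - t3*t4*M) * (c * (1 - p*M))"
    "coeff_d q t1 t2 t3 t4 n * (1 - t1*t2*M) = (1 - t3*t4*M) * d"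
    unfolding coeff_a_def coeff_b_def coeff_c_def coeff_d_def pows p_def[symmetric] a_def b_def c_def d_def
    using nzM by (simp_all add: mult_ac)
  have coeffs': "of_real (coeff_a q t1 t2 t3 t4 n) * (1 - of_real (t3*t4*q^Suc m)) = (1 - of_real (t3*t4*q^m)) * complex_of_real (a * (1 - p*M))"
    "of_real (coeff_c q t1 t2 t3 t4 n) * (1 - of_real (t1*t2*q^Suc m)) = (1 - of_real (t3*t4*q^m)) * complex_of_real (c * (1 - p*M))"
    "of_real (coeff_d q t1 t2 t3 t4 n) * (1 - of_real (t1*t2*q^m)) = (1 - of_real (t3*t4*q^m)) * complex_of_real d"
    using arg_cong[OF coeffs(1), of complex_of_real] arg_cong[OF coeffs(3), of complex_of_real]
      arg_cong[OF coeffs(4), of complex_of_real] by (simp_all add: M_def N_def)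
  have rec: "Xs L m / z = of_real (a * (1 - p*M)) * Xs L (Suc m) + of_real b * Xs L m + of_real (c * (1 - p*M)) * Ys L (Suc m) + of_real d * Ys L m"
    using recurrence[of m L] unfolding a_def b_def c_def d_def p_def N_def M_def by (simp add: L_def)
  have comb: "A * (F * E * x) + B * (G * E * y) + C * (H * E * u) + D * (I * E * w) =
      E * ((A * F) * x + B * G * y + (C * H) * u + (D * I) * w)" for A B C D E F G H I x y u w :: complex
    by (simp add: algebra_simps)
  have "1 / z * X_neg q t1 t2 t3 t4 n z = (1 - of_real (t3*t4*q^m)) * e * (Xs L m / z)"
    unfolding n by (subst X) (simp_all add: L_def)
  also have "\<dots> = of_real (coeff_a q t1 t2 t3 t4 n) * X_neg q t1 t2 t3 t4 (n + 1) z
      + of_real (coeff_b q t1 t2 t3 t4 n) * X_neg q t1 t2 t3 t4 n z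
      + of_real (coeff_c q t1 t2 t3 t4 n) * Y q t1 t2 t3 t4 n z
      + of_real (coeff_d q t1 t2 t3 t4 n) * Y q t1 t2 t3 t4 (n - 1) z"
  proof -
    have XY: "X_neg q t1 t2 t3 t4 (n + 1) z = (1 - of_real (t3*t4*q^Suc m)) * e * Xs L (Suc m)"
      "X_neg q t1 t2 t3 t4 n z = (1 - of_real (t3*t4*q^m)) * e * Xs L m"
      "Y q t1 t2 t3 t4 n z = (1 - of_real (t1*t2*q^Suc m)) * e * Ys L (Suc m)"
      "Y q t1 t2 t3 t4 (n - 1) z = (1 - of_real (t1*t2*q^m)) * e * Ys L m"
      using X[of "Suc m"] X[of m] Y[of "Suc m"] Y[of m] by (simp_all add: n L_def)
    show ?thesis unfolding XY comb coeffs' coeffs(2) rec by (simp only: ring_distribs mult_ac)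
  qed
  finally show "1 / z * X_neg q t1 t2 t3 t4 n z =
      of_real (coeff_a q t1 t2 t3 t4 n) * X_neg q t1 t2 t3 t4 (n + 1) z
      + of_real (coeff_b q t1 t2 t3 t4 n) * X_neg q t1 t2 t3 t4 n z
      + of_real (coeff_c q t1 t2 t3 t4 n) * Y q t1 t2 t3 t4 n z
      + of_real (coeff_d q t1 t2 t3 t4 n) * Y q t1 t2 t3 t4 (n - 1) z" .
qed

end
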